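(* Suppose the rate-power functions are linear, i.e. $C_{ij}(P_i)=\gamma P_i h_{ij}$ for all links $i$-$j$, where $\gamma>0$ is a constant, $h_{ij}$ is the channel gain of link $i$-$j$ and $P_i$ is the power spectral density of node $i$. Let $\mathcal{R}_{opt}$ be the set of relay nodes taking part in the optimal solution of the minimum energy routing problem with delay constraint (defined in the context). Then the decoding order of the nodes in $\mathcal{R}_{opt}$ under the greedy transmission strategy (defined in the context) is the same for all non-zero power allocations, i.e. for all choices of power spectral densities $P_i>0$ for the source and for the nodes $i\in\mathcal{R}_{opt}$. Further, the sum total power required to transmit a packet from the source to the destination, i.e. $\sum_j \Delta_j P_j$ (where $\Delta_j$ is the duration of stage $j$ of the greedy transmission strategy and $P_j$ is the power spectral density of the node transmitting in stage $j$), is the same for all non-zero power allocations.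
   Context: Network: a source $s$, a destination $d$, and $n$ relay nodes, with bandwidth normalized to $1$. Channel gains do not vary with time, and transmissions are orthogonal in time (at most one node transmits at any given time). If node $i$ transmits for a duration $\Delta$ with power spectral density (PSD) $P$, every other node $m$ that does not yet have the packet accumulates $\Delta\, C_{im}(P)$ bits of mutual information, where $C_{im}(P)$ is the transmission capacity of link $i$-$m$, and contributions from different transmissions add up. A node can transmit only after it has decoded the packet, which requires accumulating at least $I_{max}$ bits. Initially only $s$ has the packet. Minimum energy routing problem with delay constraint $D_{max}$: for a relay subset $\mathcal{R}$ with $|\mathcal{R}|=k$ and an ordering $\mathcal{O}$ of it (the decoding order), label the relays $1,\ldots,k$ according to $\mathcal{O}$, the source $0$, the destination $k+1$. Stage $j$ ($0\le j\le k$) is the time interval between the decoding time of node $j$ (the start time if $j=0$) and that of node $j+1$, with duration $\Delta_j$; $A_{ij}$ and $P_{ij}$ are the transmission duration and PSD of node $i$ in stage $j$. One minimizes $\sum_{j=0}^k\sum_{i=0}^jA_{ij}P_{ij}$ subject to $\sum_{j=0}^k\Delta_j\le D_{max}$; $\sum_{i=0}^{m-1}\sum_{j=0}^{m-1}A_{ij}C_{im}(P_{ij})\ge I_{max}$ for $m\in\{1,\ldots,k+1\}$; $\sum_{i=0}^jA_{ij}\le\Delta_j$ for $j\in\{0,\ldots,k\}$; $A_{ij},P_{ij},\Delta_j\ge0$; and $A_{ij}=P_{ij}=0$ for $i>j$. The problem is to minimize over all $\mathcal{R}$, $\mathcal{O}$ and feasible variables; $\mathcal{R}_{opt}$ denotes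 the relay set of the optimal solution, each node of which, by definition, transmits for a non-zero duration. Greedy transmission strategy on a relay set, for given PSDs $P_i>0$ (one for each transmitting node): the source transmits first (stage $0$) and continues to do so until any node in the set decodes the packet; then the source stops and the node that has just decoded transmits (stage $1$) until another node in the set that does not yet have the packet decodes it; then that node transmits (stage $2$), and so on. This process continues until the destination is able to decode the packet. Nodes accumulate mutual information over all stages. *)

theory Defs
  imports Complex_Main
begin

text \<open>
  Nodes have an arbitrary type \<open>'v\<close>; \<open>s\<close> is the source, \<open>d\<close> the destination and \<open>N\<close> the finite set
  of relay nodes. \<open>C i m p\<close> is the capacity of link \<open>i\<close>-\<open>m\<close> when \<open>i\<close> transmits with PSD \<open>p\<close>.
  The list \<open>rs\<close> gives at once a relay subset (\<open>set rs\<close>) and an ordering of it.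
\<close>

definition is_network :: "'v \<Rightarrow> 'v \<Rightarrow> 'v set \<Rightarrow> bool" where
  "is_network s d N \<longleftrightarrow> finite N \<and> s \<notin> N \<and> d \<notin> N \<and> s \<noteq> d"

definition nodes :: "'v \<Rightarrow> 'v \<Rightarrow> 'v set \<Rightarrow> 'v set" where
  "nodes s d N = insert s (insert d N)"

text \<open>The node with label \<open>i\<close>: the source is \<open>0\<close>, the destination is \<open>length rs + 1\<close>.\<close>

definition node_at :: "'v \<Rightarrow> 'v \<Rightarrow> 'v list \<Rightarrow> nat \<Rightarrow> 'v" where
  "node_at s d rs i = (s # rs @ [d]) ! i"

text \<open>In \<open>A i j\<close> and \<open>P i j\<close> the first index is the transmitting node, the second one the stage.\<close>

definition feasible ::
  "('v \<Rightarrow> 'v \<Rightarrow> real \<Rightarrow> real) \<Rightarrow> real \<Rightarrow> real \<Rightarrow> 'v \<Rightarrow> 'v \<Rightarrow> 'v set \<Rightarrow> 'v list \<Rightarrow>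
   (nat \<Rightarrow> nat \<Rightarrow> real) \<Rightarrow> (nat \<Rightarrow> nat \<Rightarrow> real) \<Rightarrow> (nat \<Rightarrow> real) \<Rightarrow> bool" where
  "feasible C Imax Dmax s d N rs A P \<Delta> \<longleftrightarrow>
     distinct rs \<and> set rs \<subseteq> N \<and>
     (let k = length rs; v = node_at s d rs in
       (\<Sum>j\<le>k. \<Delta> j) \<le> Dmax \<and>
       (\<forall>m\<in>{1..k + 1}. (\<Sum>i<m. \<Sum>j<m. A i j * C (v i) (v m) (P i j)) \<ge> Imax) \<and>
       (\<forall>j\<le>k. (\<Sum>i\<le>j. A i j) \<le> \<Delta> j) \<and>
       (\<forall>i\<le>k. \<forall>j\<le>k. A i j \<ge> 0 \<and> P i j \<ge> 0 \<and> \<Delta> j \<ge> 0) \<and>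
       (\<forall>i\<le>k. \<forall>j\<le>k. i > j \<longrightarrow> A i j = 0 \<and> P i j = 0))"

definition energy :: "nat \<Rightarrow> (nat \<Rightarrow> nat \<Rightarrow> real) \<Rightarrow> (nat \<Rightarrow> nat \<Rightarrow> real) \<Rightarrow> real" where
  "energy k A P = (\<Sum>j\<le>k. \<Sum>i\<le>j. A i j * P i j)"

definition optimal_solution ::
  "('v \<Rightarrow> 'v \<Rightarrow> real \<Rightarrow> real) \<Rightarrow> real \<Rightarrow> real \<Rightarrow> 'v \<Rightarrow> 'v \<Rightarrow> 'v set \<Rightarrow> 'v list \<Rightarrow>
   (nat \<Rightarrow> nat \<Rightarrow> real) \<Rightarrow> (nat \<Rightarrow> nat \<Rightarrow> real) \<Rightarrow> (nat \<Rightarrow> real) \<Rightarrow> bool" where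
  "optimal_solution C Imax Dmax s d N rs A P \<Delta> \<longleftrightarrow>
     feasible C Imax Dmax s d N rs A P \<Delta> \<and>
     (\<forall>rs' A' P' \<Delta>'. feasible C Imax Dmax s d N rs' A' P' \<Delta>' \<longrightarrow>
        energy (length rs) A P \<le> energy (length rs') A' P')"

text \<open>
  Optimal solutions need not be unique, so being the relay set of an optimal solution is a
  predicate. Every relay in the set has to transmit for a non-zero total duration.
\<close>

definition optimal_relay_set ::
  "('v \<Rightarrow> 'v \<Rightarrow> real \<Rightarrow> real) \<Rightarrow> real \<Rightarrow> real \<Rightarrow> 'v \<Rightarrow> 'v \<Rightarrow> 'v set \<Rightarrow> 'v set \<Rightarrow> bool" where
  "optimal_relay_set C Imax Dmax s d N R \<longleftrightarrow>
     (\<exists>rs A P \<Delta>. optimal_solution C Imax Dmax s d N rs A P \<Delta> \<and> R = set rs \<and>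
        (\<forall>i\<in>{1..length rs}. (\<Sum>j\<le>length rs. A i j) > 0))"

text \<open>
  Mutual information accumulated by \<open>m\<close> after stages of durations \<open>ts\<close> in which the nodes
  \<open>xs ! 0\<close>, \<open>xs ! 1\<close>, ... transmit one after the other; \<open>P\<close> assigns a PSD to each node.
\<close>

definition accumulated ::
  "('v \<Rightarrow> 'v \<Rightarrow> real \<Rightarrow> real) \<Rightarrow> ('v \<Rightarrow> real) \<Rightarrow> 'v list \<Rightarrow> real list \<Rightarrow> 'v \<Rightarrow> real" where
  "accumulated C P xs ts m = (\<Sum>j<length ts. ts ! j * C (xs ! j) m (P (xs ! j)))"

text \<open>Nodes outside \<open>xs\<close> (the nodes that already have the packet) that are able to decode.\<close>

definition new_decoders ::
  "('v \<Rightarrow> 'v \<Rightarrow> real \<Rightarrow> real) \<Rightarrow> real \<Rightarrow> 'v \<Rightarrow> 'v set \<Rightarrow> ('v \<Rightarrow> real) \<Rightarrow> 'v list \<Rightarrow> real list \<Rightarrow> 'v set"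
  where
  "new_decoders C Imax d R P xs ts = {m \<in> insert d R - set xs. accumulated C P xs ts m \<ge> Imax}"

text \<open>
  \<open>greedy_run C Imax s d R tb P xs ts\<close>: the greedy strategy has completed stages of durations
  \<open>ts\<close>, and \<open>xs\<close> lists the nodes that have decoded so far, in decoding order, starting with \<open>s\<close>.
  A stage ends at the first instant at which some further node is able to decode. If several
  nodes reach the threshold at the same instant, the destination takes precedence (the process
  then stops); otherwise the rule \<open>tb\<close> picks the node that comes next in the decoding order, and
  the remaining ones follow after stages of duration zero.
\<close>

inductive greedy_run ::
  "('v \<Rightarrow> 'v \<Rightarrow> real \<Rightarrow> real) \<Rightarrow> real \<Rightarrow> 'v \<Rightarrow> 'v \<Rightarrow> 'v set \<Rightarrow> ('v set \<Rightarrow> 'v) \<Rightarrow> ('v \<Rightarrow> real) \<Rightarrow>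
   'v list \<Rightarrow> real list \<Rightarrow> bool"
  for C Imax s d R tb P where
  start: "greedy_run C Imax s d R tb P [s] []"
| stage: "greedy_run C Imax s d R tb P xs ts \<Longrightarrow> d \<notin> set xs \<Longrightarrow> \<Delta> \<ge> 0 \<Longrightarrow>
    S = new_decoders C Imax d R P xs (ts @ [\<Delta>]) \<Longrightarrow> S \<noteq> {} \<Longrightarrow>
    (\<And>t. 0 \<le> t \<Longrightarrow> t < \<Delta> \<Longrightarrow> new_decoders C Imax d R P xs (ts @ [t]) = {}) \<Longrightarrow>
    greedy_run C Imax s d R tb P (xs @ [if d \<in> S then d else tb S]) (ts @ [\<Delta>])"

text \<open>
  A run is over when the destination has decoded. If the current transmitter never enables
  another node to decode (this can happen when gains vanish), the run is stuck; then \<open>xs\<close> is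
  still the complete decoding order, but the destination is not in it.
\<close>

definition greedy_outcome ::
  "('v \<Rightarrow> 'v \<Rightarrow> real \<Rightarrow> real) \<Rightarrow> real \<Rightarrow> 'v \<Rightarrow> 'v \<Rightarrow> 'v set \<Rightarrow> ('v set \<Rightarrow> 'v) \<Rightarrow> ('v \<Rightarrow> real) \<Rightarrow>
   'v list \<Rightarrow> real list \<Rightarrow> bool" where
  "greedy_outcome C Imax s d R tb P xs ts \<longleftrightarrow>
     greedy_run C Imax s d R tb P xs ts \<and>
     (d \<in> set xs \<or> (\<forall>t\<ge>0. new_decoders C Imax d R P xs (ts @ [t]) = {}))"

definition total_power :: "('v \<Rightarrow> real) \<Rightarrow> 'v list \<Rightarrow> real list \<Rightarrow> real" where
  "total_power P xs ts = (\<Sum>j<length ts. ts ! j * P (xs ! j))"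

end

theory Submission
  imports Defs
begin

text \<open>
  With linear rate-power functions a stage matters only through its energy: transmitting with
  PSD \<open>p\<close> for a duration \<open>t\<close> contributes \<open>\<gamma> * (t * p) * h\<close>. Stretching every stage by the factor
  \<open>P x / P' x\<close>, where \<open>x\<close> is the transmitter, therefore turns the greedy runs for the power
  allocation \<open>P\<close> into those for \<open>P'\<close>, with the same decoding order and the same energies. For a
  fixed allocation the greedy strategy is deterministic, so it suffices to run it once, with unit
  PSDs.
\<close>

section \<open>Thresholds of affine functions and rescaled durations\<close>

text \<open>If the threshold is not met at time 0 but is met at some \<open>t \<ge> 0\<close>, the
  slope must be positive, so \<open>(b - a) / c\<close> is the first hitting time. It will be
  applied to the information of one node as a function of the duration of the current stage.\<close>

lemma affine_first_hit:
  fixes a b c t :: real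
  assumes "t \<ge> 0" "b \<le> a + t * c"
  obtains \<tau> where "\<tau> \<ge> 0" "b \<le> a + \<tau> * c" "\<And>u. 0 \<le> u \<Longrightarrow> u < \<tau> \<Longrightarrow> a + u * c < b"
proof (cases "b \<le> a")
  case True
  show ?thesis using that[of 0] True by simp
next
  case False
  with assms have "t * c > 0" by simp
  with assms(1) have c: "c > 0" by (simp add: zero_less_mult_iff)
  show ?thesis
    by (rule that[of "(b - a) / c"]) (use False c in \<open>auto simp: field_simps\<close>)
qed

lemma accumulated_snoc:
  assumes "length ts < length xs"
  shows "accumulated C P xs (ts @ [t]) m =
    accumulated C P xs ts m + t * C (xs ! length ts) m (P (xs ! length ts))"
  using assms by (simp add: accumulated_def nth_append)

text \<open>These durations give every stage under \<open>P'\<close> the energy it has under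
  \<open>P\<close>. Only indices below \<open>length ts\<close> are read, so the PSD of the last
  node of a run, possibly \<open>d\<close>, does not enter.\<close>

definition rescale :: "('v \<Rightarrow> real) \<Rightarrow> ('v \<Rightarrow> real) \<Rightarrow> 'v list \<Rightarrow> real list \<Rightarrow> real list" where
  "rescale P P' xs ts = map (\<lambda>j. ts ! j * P (xs ! j) / P' (xs ! j)) [0..<length ts]"

lemma length_rescale [simp]: "length (rescale P P' xs ts) = length ts"
  by (simp add: rescale_def)

lemma rescale_Nil [simp]: "rescale P P' xs [] = []"
  by (simp add: rescale_def)

lemma rescale_snoc:
  "rescale P P' xs (ts @ [t]) =
    rescale P P' xs ts @ [t * P (xs ! length ts) / P' (xs ! length ts)]"
  by (simp add: rescale_def nth_append)

lemma rescale_append: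
  assumes "length ts \<le> length xs"
  shows "rescale P P' (xs @ ys) ts = rescale P P' xs ts"
  using assms by (simp add: rescale_def nth_append)

lemma total_power_rescale:
  assumes "\<And>j. j < length ts \<Longrightarrow> P' (xs ! j) \<noteq> 0"
  shows "total_power P' xs (rescale P P' xs ts) = total_power P xs ts"
  using assms by (simp add: total_power_def rescale_def)

text \<open>Linearity is restricted to the links a greedy run can use: transmitters in
  \<open>insert s R\<close>, receivers in \<open>insert d R\<close>.\<close>

locale greedy_network =
  fixes s d :: 'v and R :: "'v set" and C :: "'v \<Rightarrow> 'v \<Rightarrow> real \<Rightarrow> real"
    and h :: "'v \<Rightarrow> 'v \<Rightarrow> real" and \<gamma> Imax :: real and tb :: "'v set \<Rightarrow> 'v"
  assumes finite_relays: "finite R"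
    and linear: "\<And>i m p. i \<in> insert s R \<Longrightarrow> m \<in> insert d R \<Longrightarrow> i \<noteq> m \<Longrightarrow> p \<ge> 0 \<Longrightarrow>
                   C i m p = \<gamma> * p * h i m"
    and tie_breaking: "\<And>S. S \<noteq> {} \<Longrightarrow> S \<subseteq> R \<Longrightarrow> tb S \<in> S"
begin

abbreviation run where "run \<equiv> greedy_run C Imax s d R tb"
abbreviation outcome where "outcome \<equiv> greedy_outcome C Imax s d R tb"
abbreviation decoders where "decoders \<equiv> new_decoders C Imax d R"

section \<open>Structure of greedy runs\<close>

text \<open>Since \<open>d\<close> takes precedence, \<open>tb\<close> is consulted only on sets of
  relays, where it is assumed to choose a member.\<close>

lemma next_decoder:
  assumes "decoders P xs ts \<noteq> {}"
  shows "(if d \<in> decoders P xs ts then d else tb (decoders P xs ts)) \<in> insert d R - set xs"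
proof (cases "d \<in> decoders P xs ts")
  case True
  then show ?thesis by (auto simp: new_decoders_def)
next
  case False
  then have "decoders P xs ts \<subseteq> R" by (auto simp: new_decoders_def)
  with assms have "tb (decoders P xs ts) \<in> decoders P xs ts" by (rule tie_breaking)
  with False show ?thesis by (auto simp: new_decoders_def)
qed

text \<open>The last entry of \<open>xs\<close> has decoded but has not completed a stage, whence
  the extra entry. As no stage starts once \<open>d\<close> has decoded, \<open>d\<close> can never
  be among the nodes that have completed a stage.\<close>

lemma run_invariants:
  assumes "run P xs ts"
  shows "length xs = Suc (length ts)" "distinct xs" "set xs \<subseteq> insert s (insert d R)"
    "d \<notin> set (take (length ts) xs)"
proof -
  have "length xs = Suc (length ts) \<and> distinct xs \<and> set xs \<subseteq> insert s (insert d R) \<and>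
    d \<notin> set (take (length ts) xs)"
    using assms
  proof induction
    case start
    show ?case by simp
  next
    case (stage xs ts \<Delta> S)
    then show ?case using next_decoder[of P xs "ts @ [\<Delta>]"] by auto
  qed
  then show "length xs = Suc (length ts)" "distinct xs" "set xs \<subseteq> insert s (insert d R)"
    "d \<notin> set (take (length ts) xs)" by auto
qed

lemma run_transmitter:
  assumes "run P xs ts" "j < length ts"
  shows "xs ! j \<in> insert s R"
proof -
  have "xs ! j \<in> set (take (length ts) xs)"
    using assms run_invariants(1)[OF assms(1)] by (auto simp: in_set_conv_nth)
  moreover have "set (take (length ts) xs) \<subseteq> set xs" by (rule set_take_subset)
  ultimately show ?thesis using run_invariants(3,4)[OF assms(1)] by auto
qed

text \<open>Allows runs of different lengths to be compared by truncating the longer one.\<close>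

lemma run_take:
  assumes "run P xs ts" "n \<le> length ts"
  shows "run P (take (Suc n) xs) (take n ts)"
  using assms
proof induction
  case start
  show ?case by (simp add: greedy_run.start)
next
  case (stage xs ts \<Delta> S)
  have len: "length xs = Suc (length ts)" using stage.hyps(1) by (rule run_invariants)
  show ?case
  proof (cases "n \<le> length ts")
    case True
    with stage.IH len show ?thesis by simp
  next
    case False
    with stage.prems have "n = Suc (length ts)" by simp
    then show ?thesis using greedy_run.stage[OF stage.hyps] len by simp
  qed
qed

section \<open>Determinism of the greedy strategy\<close>

lemma run_snocE:
  assumes "run P zs (us @ [u])"
  obtains xs S where "run P xs us" "d \<notin> set xs" "u \<ge> 0" "S = decoders P xs (us @ [u])" "S \<noteq> {}"
    "\<And>t. 0 \<le> t \<Longrightarrow> t < u \<Longrightarrow> decoders P xs (us @ [t]) = {}"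
    "zs = xs @ [if d \<in> S then d else tb S]"
  using assms by (cases rule: greedy_run.cases) auto

text \<open>By induction both runs agree before the last stage. That stage ends at the first instant
  with a decoder, which fixes its duration, and then the next node is fixed by
  \<open>tb\<close>.\<close>

lemma run_unique:
  assumes "run P xs ts" "run P ys us" "length ts = length us"
  shows "xs = ys \<and> ts = us"
  using assms
proof (induction arbitrary: ys us)
  case start
  then show ?case using greedy_run.cases[OF start.prems(1)] by fastforce
next
  case (stage xs ts \<Delta> S)
  from stage.prems(2) obtain us' u where us: "us = us' @ [u]"
    by (cases us rule: rev_cases) auto
  from stage.prems(1) obtain zs S' where
    zs: "run P zs us'" "u \<ge> 0" "S' = decoders P zs (us' @ [u])" "S' \<noteq> {}"
      "\<And>t. 0 \<le> t \<Longrightarrow> t < u \<Longrightarrow> decoders P zs (us' @ [t]) = {}"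
      "ys = zs @ [if d \<in> S' then d else tb S']"
    unfolding us by (elim run_snocE) blast
  have eq: "xs = zs \<and> ts = us'" using stage.IH[OF zs(1)] stage.prems(2) us by simp
  have "\<Delta> = u"
  proof (rule ccontr)
    assume "\<Delta> \<noteq> u"
    then have "\<Delta> < u \<or> u < \<Delta>" by auto
    \<comment> \<open>The shorter of the two durations already admits a decoder, contradicting the
      minimality of the longer one.\<close>
    then show False using eq zs stage.hyps by auto
  qed
  then show ?case using eq zs stage.hyps us by simp
qed

text \<open>A longer run, cut to one stage more than the outcome, would by uniqueness extend the
  outcome itself, which is either finished or stuck.\<close>

lemma outcome_maximal:
  assumes "outcome P xs ts" "run P ys us"
  shows "length us \<le> length ts"
proof (rule ccontr)
  assume "\<not> length us \<le> length ts"
  then have lt: "length ts < length us" by simp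
  have "run P (take (Suc (Suc (length ts))) ys) (take (length ts) us @ [us ! length ts])"
    using run_take[OF assms(2), of "Suc (length ts)"] lt by (simp add: take_Suc_conv_app_nth)
  then obtain zs where zs: "run P zs (take (length ts) us)" "d \<notin> set zs" "us ! length ts \<ge> 0"
    "decoders P zs (take (length ts) us @ [us ! length ts]) \<noteq> {}"
    by (elim run_snocE) blast
  have "run P xs ts" using assms(1) by (simp add: greedy_outcome_def)
  from run_unique[OF this zs(1)] lt have "xs = zs \<and> ts = take (length ts) us" by simp
  with zs assms(1) show False by (auto simp: greedy_outcome_def)
qed

lemma outcome_unique:
  assumes "outcome P xs ts" "outcome P ys us"
  shows "xs = ys \<and> ts = us"
proof -
  have runs: "run P xs ts" "run P ys us" using assms by (simp_all add: greedy_outcome_def)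
  have "length ts = length us"
    using outcome_maximal[OF assms(1) runs(2)] outcome_maximal[OF assms(2) runs(1)] by simp
  with runs show ?thesis by (rule run_unique)
qed

section \<open>Existence of an outcome\<close>

text \<open>During a stage the information of each node is affine in the elapsed time, so every node
  that can decode has a first decoding time. The minimum over these finitely many nodes is
  attained.\<close>

lemma first_decoding_time:
  assumes len: "length ts < length xs" and t: "t \<ge> 0" "decoders P xs (ts @ [t]) \<noteq> {}"
  obtains \<Delta> where "\<Delta> \<ge> 0" "decoders P xs (ts @ [\<Delta>]) \<noteq> {}"
    "\<And>u. 0 \<le> u \<Longrightarrow> u < \<Delta> \<Longrightarrow> decoders P xs (ts @ [u]) = {}"
proof -
  define acc where "acc m u = accumulated C P xs (ts @ [u]) m" for m u
  \<comment> \<open>The nodes that would decode if the current transmitter went on long enough; only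
    these have a hitting time.\<close>
  define M where "M = {m \<in> insert d R - set xs. \<exists>u\<ge>0. Imax \<le> acc m u}"
  have "finite M" using finite_relays by (simp add: M_def)
  have "M \<noteq> {}" using t by (auto simp: M_def acc_def new_decoders_def)
  have "\<exists>\<tau>\<ge>0. Imax \<le> acc m \<tau> \<and> (\<forall>u\<ge>0. u < \<tau> \<longrightarrow> acc m u < Imax)" if m: "m \<in> M" for m
  proof -
    from m obtain u where u: "u \<ge> 0" "Imax \<le> acc m u" by (auto simp: M_def)
    from u show ?thesis unfolding acc_def accumulated_snoc[OF len]
      by (rule affine_first_hit) blast
  qed
  then obtain \<tau> where \<tau>: "\<And>m. m \<in> M \<Longrightarrow> \<tau> m \<ge> 0" "\<And>m. m \<in> M \<Longrightarrow> Imax \<le> acc m (\<tau> m)"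
    "\<And>m u. m \<in> M \<Longrightarrow> u \<ge> 0 \<Longrightarrow> u < \<tau> m \<Longrightarrow> acc m u < Imax"
    by metis
  define \<Delta> where "\<Delta> = Min (\<tau> ` M)"
  have "\<Delta> \<in> \<tau> ` M" unfolding \<Delta>_def using \<open>finite M\<close> \<open>M \<noteq> {}\<close> by simp
  then obtain m0 where m0: "m0 \<in> M" "\<Delta> = \<tau> m0" by auto
  have \<Delta>_le: "\<Delta> \<le> \<tau> m" if "m \<in> M" for m using \<open>finite M\<close> that by (simp add: \<Delta>_def)
  show ?thesis
  proof (rule that)
    show "\<Delta> \<ge> 0" using \<tau> m0 by simp
    show "decoders P xs (ts @ [\<Delta>]) \<noteq> {}"
      using \<tau>(2)[OF m0(1)] m0 by (auto simp: new_decoders_def acc_def M_def)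
    show "decoders P xs (ts @ [u]) = {}" if u: "0 \<le> u" "u < \<Delta>" for u
    proof (rule ccontr)
      assume "decoders P xs (ts @ [u]) \<noteq> {}"
      then obtain m where "m \<in> M" "Imax \<le> acc m u"
        using u by (auto simp: new_decoders_def acc_def M_def)
      then show False using \<tau>(3)[of m u] \<Delta>_le[of m] u by auto
    qed
  qed
qed

text \<open>Entries of a run are distinct, so run lengths are bounded. A run of maximal length is an
  outcome, since otherwise \<open>first_decoding_time\<close> would supply one more stage.\<close>

lemma outcome_exists: "\<exists>xs ts. outcome P xs ts"
proof -
  have bound: "length ts \<le> Suc (card (insert d R))" if "run P xs ts" for xs ts
  proof -
    have "length xs = card (set xs)" using run_invariants(2)[OF that] by (simp add: distinct_card)
    also have "\<dots> \<le> card (insert s (insert d R))"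
      using run_invariants(3)[OF that] finite_relays by (intro card_mono) auto
    also have "\<dots> \<le> Suc (card (insert d R))" using finite_relays by (simp add: card_insert_if)
    finally show ?thesis using run_invariants(1)[OF that] by simp
  qed
  define L where "L = {length ts |xs ts. run P xs ts}"
  have "finite L"
    by (rule finite_subset[of _ "{..Suc (card (insert d R))}"]) (use bound in \<open>auto simp: L_def\<close>)
  moreover have "L \<noteq> {}" using greedy_run.start[of C Imax s d R tb P] by (auto simp: L_def)
  ultimately have "Max L \<in> L" by (rule Max_in)
  then obtain xs ts where run: "run P xs ts" and "length ts = Max L" by (auto simp: L_def)
  with \<open>finite L\<close> have max: "length us \<le> length ts" if "run P ys us" for ys us
    using that by (auto simp: L_def intro: Max_ge)
  have len: "length ts < length xs" using run_invariants(1)[OF run] by simp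
  have "decoders P xs (ts @ [t]) = {}" if d: "d \<notin> set xs" and t: "t \<ge> 0" for t
  proof (rule ccontr)
    assume "decoders P xs (ts @ [t]) \<noteq> {}"
    from first_decoding_time[OF len t this] obtain \<Delta> where "\<Delta> \<ge> 0"
      "decoders P xs (ts @ [\<Delta>]) \<noteq> {}"
      "\<And>u. 0 \<le> u \<Longrightarrow> u < \<Delta> \<Longrightarrow> decoders P xs (ts @ [u]) = {}" by blast
    from max[OF greedy_run.stage[OF run d this(1) refl this(2,3)]] show False by simp
  qed
  with run show ?thesis by (auto simp: greedy_outcome_def)
qed

section \<open>Invariance under a change of power allocation\<close>

text \<open>By linearity each summand of the accumulated information depends on duration and PSD
  only through their product, which \<open>rescale\<close> preserves. A receiver outside
  \<open>xs\<close> differs from every transmitter, as linearity requires.\<close>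

lemma decoders_rescale:
  assumes P: "\<forall>i\<in>insert s R. P i > 0" "\<forall>i\<in>insert s R. P' i > 0"
    and xs: "length ts \<le> length xs" "set xs \<subseteq> insert s R"
  shows "decoders P' xs (rescale P P' xs ts) = decoders P xs ts"
proof -
  have "accumulated C P' xs (rescale P P' xs ts) m = accumulated C P xs ts m"
    if m: "m \<in> insert d R - set xs" for m
    unfolding accumulated_def
  proof (intro sum.cong)
    fix j assume "j \<in> {..<length ts}"
    then have j: "j < length ts" by simp
    with xs(1) have "xs ! j \<in> set xs" by simp
    with xs(2) have x: "xs ! j \<in> insert s R" "xs ! j \<in> set xs" by blast+
    with m have "xs ! j \<noteq> m" by auto
    moreover have "m \<in> insert d R" using m by simp
    ultimately show "rescale P P' xs ts ! j * C (xs ! j) m (P' (xs ! j)) =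
        ts ! j * C (xs ! j) m (P (xs ! j))"
      using x(1) P[THEN bspec, OF x(1)] j by (simp add: less_imp_le linear rescale_def)
  qed simp
  then show ?thesis by (auto simp: new_decoders_def)
qed

text \<open>The second claim transports a given stage from \<open>P\<close> to \<open>P'\<close>.
  The third reads an arbitrary duration under \<open>P'\<close> back as one under \<open>P\<close>,
  which is what statements about all durations need.\<close>

lemma decoders_rescale_snoc:
  assumes P: "\<forall>i\<in>insert s R. P i > 0" "\<forall>i\<in>insert s R. P' i > 0"
    and run: "run P xs ts" and d: "d \<notin> set xs"
  shows "xs ! length ts \<in> insert s R"
    and "decoders P' xs (rescale P P' xs ts @ [t * P (xs ! length ts) / P' (xs ! length ts)]) =
      decoders P xs (ts @ [t])"
    and "decoders P' xs (rescale P P' xs ts @ [t]) =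
      decoders P xs (ts @ [t * P' (xs ! length ts) / P (xs ! length ts)])"
proof -
  let ?x = "xs ! length ts"
  have len: "length xs = Suc (length ts)" using run by (rule run_invariants)
  have sub: "set xs \<subseteq> insert s R" using run_invariants(3)[OF run] d by auto
  have "?x \<in> set xs" using len by simp
  with sub show x: "?x \<in> insert s R" by blast
  have *: "decoders P' xs (rescale P P' xs ts @ [u * P ?x / P' ?x]) =
      decoders P xs (ts @ [u])" for u
    using decoders_rescale[OF P, where ts = "ts @ [u]" and xs = xs] len sub
    by (simp add: rescale_snoc)
  show "decoders P' xs (rescale P P' xs ts @ [t * P ?x / P' ?x]) = decoders P xs (ts @ [t])"
    by (rule *)
  show "decoders P' xs (rescale P P' xs ts @ [t]) = decoders P xs (ts @ [t * P' ?x / P ?x])"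
    using *[of "t * P' ?x / P ?x"] P[THEN bspec, OF x] by simp
qed

text \<open>Multiplying durations by a positive factor preserves their order, so the first decoding
  instant of a stage is mapped to the first decoding instant.\<close>

lemma run_rescale:
  assumes P: "\<forall>i\<in>insert s R. P i > 0" "\<forall>i\<in>insert s R. P' i > 0"
    and "run P xs ts"
  shows "run P' xs (rescale P P' xs ts)"
  using assms(3)
proof induction
  case start
  show ?case by (simp add: greedy_run.start)
next
  case (stage xs ts \<Delta> S)
  let ?x = "xs ! length ts"
  note rs = decoders_rescale_snoc[OF P stage.hyps(1,2)]
  have pos: "P ?x > 0" "P' ?x > 0" using P[THEN bspec, OF rs(1)] by auto
  have len: "length xs = Suc (length ts)" using stage.hyps(1) by (rule run_invariants)
  have "run P' (xs @ [if d \<in> S then d else tb S])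
      (rescale P P' xs ts @ [\<Delta> * P ?x / P' ?x])"
  proof (rule greedy_run.stage[OF stage.IH stage.hyps(2)])
    show "\<Delta> * P ?x / P' ?x \<ge> 0" using pos stage.hyps(3) by simp
    show "S = decoders P' xs (rescale P P' xs ts @ [\<Delta> * P ?x / P' ?x])"
      using stage.hyps(4) rs(2) by simp
    show "S \<noteq> {}" by (rule stage.hyps(5))
    show "decoders P' xs (rescale P P' xs ts @ [t]) = {}"
      if t: "0 \<le> t" "t < \<Delta> * P ?x / P' ?x" for t
      \<comment> \<open>Read back under \<open>P\<close>, a duration below the rescaled one lies
        below \<open>\<Delta>\<close>.\<close>
      unfolding rs(3) using t pos by (intro stage.hyps(6)) (simp_all add: field_simps)
  qed
  then show ?case using len by (simp add: rescale_append rescale_snoc nth_append)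
qed

lemma outcome_rescale:
  assumes P: "\<forall>i\<in>insert s R. P i > 0" "\<forall>i\<in>insert s R. P' i > 0"
    and out: "outcome P xs ts"
  shows "outcome P' xs (rescale P P' xs ts)"
    and "total_power P' xs (rescale P P' xs ts) = total_power P xs ts"
proof -
  have run: "run P xs ts" using out by (simp add: greedy_outcome_def)
  have "decoders P' xs (rescale P P' xs ts @ [t]) = {}" if d: "d \<notin> set xs" and t: "t \<ge> 0" for t
  proof -
    note rs = decoders_rescale_snoc[OF P run d]
    have "t * P' (xs ! length ts) / P (xs ! length ts) \<ge> 0" using P[THEN bspec, OF rs(1)] t by simp
    with out d show ?thesis unfolding rs(3) greedy_outcome_def by blast
  qed
  with run_rescale[OF P run] show "outcome P' xs (rescale P P' xs ts)"
    by (auto simp: greedy_outcome_def)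
  show "total_power P' xs (rescale P P' xs ts) = total_power P xs ts"
    using P(2)[THEN bspec, OF run_transmitter[OF run]] by (intro total_power_rescale) fastforce
qed

section \<open>Reaching the destination when gains are positive\<close>

text \<open>The current transmitter feeds \<open>d\<close> at a positive rate, so \<open>d\<close>
  would eventually decode and the run cannot be stuck.\<close>

lemma outcome_reaches_destination:
  assumes "outcome P xs ts" and \<gamma>: "\<gamma> > 0"
    and P: "\<forall>i\<in>insert s R. P i > 0"
    and h: "\<And>i. i \<in> insert s R \<Longrightarrow> i \<noteq> d \<Longrightarrow> h i d > 0"
  shows "d \<in> set xs"
proof (rule ccontr)
  assume d: "d \<notin> set xs"
  let ?x = "xs ! length ts"
  have run: "run P xs ts" using assms(1) by (simp add: greedy_outcome_def)
  have len: "length xs = Suc (length ts)" using run by (rule run_invariants)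
  have "?x \<in> set xs" using len by simp
  then have x: "?x \<in> insert s R" "?x \<noteq> d" using run_invariants(3)[OF run] d by auto
  define a where "a = accumulated C P xs ts d"
  define c where "c = \<gamma> * P ?x * h ?x d"
  \<comment> \<open>The time that supplies the missing \<open>Imax - a\<close> at rate
    \<open>c\<close>; the maximum keeps it non-negative.\<close>
  define t where "t = max 0 ((Imax - a) / c)"
  have c: "c > 0" using \<gamma> P[THEN bspec, OF x(1)] h[OF x] by (simp add: c_def)
  have "(Imax - a) / c \<le> t" by (simp add: t_def)
  with c have "Imax \<le> a + t * c" by (simp add: field_simps)
  also have "\<dots> = accumulated C P xs (ts @ [t]) d"
    using len x P[THEN bspec, OF x(1)] by (simp add: accumulated_snoc linear a_def c_def)
  finally have "d \<in> decoders P xs (ts @ [t])" using d by (simp add: new_decoders_def)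
  moreover have "t \<ge> 0" by (simp add: t_def)
  ultimately show False using assms(1) d by (auto simp: greedy_outcome_def)
qed

end

theorem theorem3:
  fixes s d :: 'v and N Ropt :: "'v set"
    and C :: "'v \<Rightarrow> 'v \<Rightarrow> real \<Rightarrow> real" and h :: "'v \<Rightarrow> 'v \<Rightarrow> real"
    and \<gamma> Imax Dmax :: real and tb :: "'v set \<Rightarrow> 'v"
  assumes network: "is_network s d N"
    and gains: "\<And>i m. i \<in> nodes s d N \<Longrightarrow> m \<in> nodes s d N \<Longrightarrow> i \<noteq> m \<Longrightarrow> h i m \<ge> 0"
    and gamma: "\<gamma> > 0"
    and Imax: "Imax > 0"
    and linear: "\<And>i m p. i \<in> nodes s d N \<Longrightarrow> m \<in> nodes s d N \<Longrightarrow> i \<noteq> m \<Longrightarrow> p \<ge> 0 \<Longrightarrow>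
                   C i m p = \<gamma> * p * h i m"
    and optimal: "optimal_relay_set C Imax Dmax s d N Ropt"
    and tie_breaking: "\<And>S. S \<noteq> {} \<Longrightarrow> S \<subseteq> Ropt \<Longrightarrow> tb S \<in> S"
  shows "\<exists>ord W.
    (\<forall>P. (\<forall>i\<in>insert s Ropt. P i > 0) \<longrightarrow>
       (\<exists>ts. greedy_outcome C Imax s d Ropt tb P ord ts) \<and>
       (\<forall>xs ts. greedy_outcome C Imax s d Ropt tb P xs ts \<longrightarrow>
          xs = ord \<and> (d \<in> set ord \<longrightarrow> total_power P xs ts = W))) \<and>
    ((\<forall>i\<in>nodes s d N. \<forall>m\<in>nodes s d N. i \<noteq> m \<longrightarrow> h i m > 0) \<longrightarrow> d \<in> set ord)"
proof -
  \<comment> \<open>Read off from the feasibility of the optimal solution.\<close>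
  have R: "Ropt \<subseteq> N"
    using optimal by (auto simp: optimal_relay_set_def optimal_solution_def feasible_def)
  interpret greedy_network s d Ropt C h \<gamma> Imax tb
  proof
    show "finite Ropt" using R network by (auto simp: is_network_def intro: finite_subset)
    show "C i m p = \<gamma> * p * h i m"
      if "i \<in> insert s Ropt" "m \<in> insert d Ropt" "i \<noteq> m" "p \<ge> 0" for i m p
      using that R by (intro linear) (auto simp: nodes_def)
  qed (rule tie_breaking)
  obtain ord us where ord: "outcome (\<lambda>_. 1) ord us" using outcome_exists by blast
  show ?thesis
  proof (intro exI[of _ ord] exI[of _ "total_power (\<lambda>_. 1) ord us"] conjI allI impI)
    fix P :: "'v \<Rightarrow> real"
    assume P: "\<forall>i\<in>insert s Ropt. P i > 0"
    let ?ts = "rescale (\<lambda>_. 1) P ord us"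
    have out: "outcome P ord ?ts" and
      W: "total_power P ord ?ts = total_power (\<lambda>_. 1) ord us"
      using P by (intro outcome_rescale[OF _ _ ord]; simp)+
    show "\<exists>ts. outcome P ord ts" using out by blast
    fix xs ts
    assume "outcome P xs ts"
    \<comment> \<open>For the allocation \<open>P\<close> the rescaled unit-PSD outcome is the only
      outcome.\<close>
    then have eq: "xs = ord" "ts = ?ts" using outcome_unique[OF _ out] by auto
    show "xs = ord" by (rule eq)
    show "total_power P xs ts = total_power (\<lambda>_. 1) ord us" using eq W by simp
  next
    assume "\<forall>i\<in>nodes s d N. \<forall>m\<in>nodes s d N. i \<noteq> m \<longrightarrow> h i m > 0"
    then show "d \<in> set ord"
      using R by (intro outcome_reaches_destination[OF ord gamma]) (auto simp: nodes_def)
  qed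
qed

end
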